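(* Let $\Sigma$ be an irreducible reduced root system with base $\Pi$ (viewed as a connected Dynkin diagram), highest root $\mu^+$, $\mu^-=-\mu^+$, and extended Dynkin diagram $\tilde\Pi=\Pi\cup\{\mu^-\}$. Suppose that $S,T\subseteq\Pi$. Then the following are equivalent: (a) $(S,T)\in\mathrm{SPA}(\Pi)$, i.e. $(S,T)$ is SP-admissible. (b) $S\neq\emptyset$ and $\chi_{(S,T)}\in\mathrm{Hom}(\Sigma,\mathrm{BC}_2)$. (c) $\chi_S(\mu^+)\in\{1,2\}$; $\chi_T(\mu^+)\in\{0,1,2\}$; and if $\chi_T(\mu^+)=2$, then $\chi_S(\mu^+)=2$ and $\mathrm{comp}(\tilde\Pi\setminus T,\mu^-)\cap S=\emptyset$.
   Context: $Q_\Sigma$ is the root lattice of $\Sigma$. For $S\subseteq\Pi$, $\chi_S\in\mathrm{Hom}(Q_\Sigma,\mathbb Z)$ is defined by $\chi_S(\lambda)=1$ if $\lambda\in S$ and $\chi_S(\lambda)=0$ if $\lambda\in\Pi\setminus S$. For $S,T\subseteq\Pi$, $\chi_{(S,T)}=(\chi_S,\chi_T)\in\mathrm{Hom}(Q_\Sigma,\mathbb Z^2)$. The root system of type $\mathrm{BC}_2$ is $\Delta=\{\pm\alpha_1,\pm\alpha_2,\pm(\alpha_1+\alpha_2),\pm2\alpha_1,\pm(2\alpha_1+\alpha_2),\pm(2\alpha_1+2\alpha_2)\}$, with root lattice identified with $\mathbb Z^2$ by $i\alpha_1+j\alpha_2\leftrightarrow(i,j)$. $\mathrm{Hom}(\Sigma,\mathrm{BC}_2)$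 is the set of $\rho\in\mathrm{Hom}(Q_\Sigma,\mathbb Z^2)$ with $\rho(\Sigma)\subseteq\Delta\cup\{0\}$. $\mathrm{Hom}_{\mathrm{sh}}(\Sigma,\mathrm{BC}_2)$ is the set of $\rho\in\mathrm{Hom}(\Sigma,\mathrm{BC}_2)$ such that $\rho(\Sigma)$ contains a short root of $\Delta$, i.e. an element of $\{\pm\alpha_1,\pm(\alpha_1+\alpha_2)\}$. A pair $(S,T)$ of subsets of $\Pi$ is SP-admissible if $\chi_{(S,T)}\in\mathrm{Hom}_{\mathrm{sh}}(\Sigma,\mathrm{BC}_2)$, and $\mathrm{SPA}(\Pi)$ is the set of SP-admissible pairs. Two distinct elements of $\tilde\Pi$ are adjacent if they are not orthogonal. For $\lambda\in Y\subseteq\tilde\Pi$, $\mathrm{comp}(Y,\lambda)$ is the connected component of $Y$ containing $\lambda$ (for this adjacency restricted to $Y$). *)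

theory Defs
  imports "HOL-Analysis.Analysis"
begin

definition root_system :: "'a::euclidean_space set \<Rightarrow> bool" where
  "root_system R \<longleftrightarrow>
     finite R \<and> 0 \<notin> R \<and> span R = UNIV \<and>
     (\<forall>\<alpha>\<in>R. \<forall>\<beta>\<in>R. \<beta> - (2 * (\<beta> \<bullet> \<alpha>) / (\<alpha> \<bullet> \<alpha>)) *\<^sub>R \<alpha> \<in> R) \<and>
     (\<forall>\<alpha>\<in>R. \<forall>\<beta>\<in>R. 2 * (\<beta> \<bullet> \<alpha>) / (\<alpha> \<bullet> \<alpha>) \<in> \<int>)"

definition reduced_roots :: "'a::euclidean_space set \<Rightarrow> bool" where
  "reduced_roots R \<longleftrightarrow> (\<forall>\<alpha>\<in>R. \<forall>c. c *\<^sub>R \<alpha> \<in> R \<longrightarrow> c = 1 \<or> c = - 1)"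

definition irreducible_roots :: "'a::euclidean_space set \<Rightarrow> bool" where
  "irreducible_roots R \<longleftrightarrow> R \<noteq> {} \<and>
     \<not> (\<exists>R1 R2. R1 \<noteq> {} \<and> R2 \<noteq> {} \<and> R1 \<union> R2 = R \<and> R1 \<inter> R2 = {} \<and>
           (\<forall>\<alpha>\<in>R1. \<forall>\<beta>\<in>R2. \<alpha> \<bullet> \<beta> = 0))"

definition nonneg_comb :: "'a::euclidean_space set \<Rightarrow> 'a \<Rightarrow> bool" where
  "nonneg_comb B x \<longleftrightarrow> (\<exists>c :: 'a \<Rightarrow> nat. x = (\<Sum>b\<in>B. of_nat (c b) *\<^sub>R b))"

definition root_base :: "'a::euclidean_space set \<Rightarrow> 'a set \<Rightarrow> bool" where
  "root_base R B \<longleftrightarrow>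
     B \<subseteq> R \<and> independent B \<and> span B = UNIV \<and>
     (\<forall>\<alpha>\<in>R. nonneg_comb B \<alpha> \<or> nonneg_comb B (- \<alpha>))"

text \<open>The highest root is the greatest root for the order in which \<open>\<alpha> \<le> \<beta>\<close> means that
  \<open>\<beta> - \<alpha>\<close> is a sum of simple roots.\<close>

definition highest_root :: "'a::euclidean_space set \<Rightarrow> 'a set \<Rightarrow> 'a \<Rightarrow> bool" where
  "highest_root R B \<mu> \<longleftrightarrow> \<mu> \<in> R \<and> (\<forall>\<alpha>\<in>R. nonneg_comb B (\<mu> - \<alpha>))"

definition root_lattice :: "'a::euclidean_space set \<Rightarrow> 'a set" where
  "root_lattice R = {x. \<exists>c :: 'a \<Rightarrow> int. x = (\<Sum>\<alpha>\<in>R. of_int (c \<alpha>) *\<^sub>R \<alpha>)}"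

text \<open>Homomorphisms on the lattice \<open>Q\<close> are made extensional (they are \<open>undefined\<close> off \<open>Q\<close>),
  so that two of them are equal iff they agree on \<open>Q\<close>.\<close>

definition lattice_Hom :: "'a::euclidean_space set \<Rightarrow> ('a \<Rightarrow> 'b::ab_group_add) set" where
  "lattice_Hom Q = {f \<in> extensional Q. \<forall>x\<in>Q. \<forall>y\<in>Q. f (x + y) = f x + f y}"

definition chi :: "'a::euclidean_space set \<Rightarrow> 'a set \<Rightarrow> 'a set \<Rightarrow> 'a \<Rightarrow> int" where
  "chi R B S = (THE f. f \<in> lattice_Hom (root_lattice R) \<and>
     (\<forall>\<alpha>\<in>S. f \<alpha> = 1) \<and> (\<forall>\<alpha>\<in>B - S. f \<alpha> = 0))"

definition chi_pair ::
    "'a::euclidean_space set \<Rightarrow> 'a set \<Rightarrow> 'a set \<Rightarrow> 'a set \<Rightarrow> 'a \<Rightarrow> int \<times> int" where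
  "chi_pair R B S T = restrict (\<lambda>x. (chi R B S x, chi R B T x)) (root_lattice R)"

text \<open>The pair \<open>(i, j)\<close> stands for \<open>i \<alpha>\<^sub>1 + j \<alpha>\<^sub>2\<close>.\<close>

definition BC2 :: "(int \<times> int) set" where
  "BC2 = {(1,0), (-1,0), (0,1), (0,-1), (1,1), (-1,-1),
          (2,0), (-2,0), (2,1), (-2,-1), (2,2), (-2,-2)}"

definition BC2_short :: "(int \<times> int) set" where
  "BC2_short = {(1,0), (-1,0), (1,1), (-1,-1)}"

definition Hom_BC2 :: "'a::euclidean_space set \<Rightarrow> ('a \<Rightarrow> int \<times> int) set" where
  "Hom_BC2 R = {\<rho> \<in> lattice_Hom (root_lattice R). \<rho> ` R \<subseteq> BC2 \<union> {0}}"

definition Hom_sh_BC2 :: "'a::euclidean_space set \<Rightarrow> ('a \<Rightarrow> int \<times> int) set" where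
  "Hom_sh_BC2 R = {\<rho> \<in> Hom_BC2 R. \<rho> ` R \<inter> BC2_short \<noteq> {}}"

definition SPA :: "'a::euclidean_space set \<Rightarrow> 'a set \<Rightarrow> ('a set \<times> 'a set) set" where
  "SPA R B = {(S, T). S \<subseteq> B \<and> T \<subseteq> B \<and> chi_pair R B S T \<in> Hom_sh_BC2 R}"

definition adjacent :: "'a::euclidean_space \<Rightarrow> 'a \<Rightarrow> bool" where
  "adjacent \<alpha> \<beta> \<longleftrightarrow> \<alpha> \<noteq> \<beta> \<and> \<alpha> \<bullet> \<beta> \<noteq> 0"

definition diagram_comp :: "'a::euclidean_space set \<Rightarrow> 'a \<Rightarrow> 'a set" where
  "diagram_comp Y x = {y \<in> Y. (x, y) \<in> {(u, v). u \<in> Y \<and> v \<in> Y \<and> adjacent u v}\<^sup>*}"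

definition extended_base :: "'a::euclidean_space set \<Rightarrow> 'a \<Rightarrow> 'a set" where
  "extended_base B \<mu> = insert (- \<mu>) B"

text \<open>The rest of this theory shows that \<^const>\<open>chi\<close> is well defined.\<close>

lemma root_lattice_0: "0 \<in> root_lattice R"
  unfolding root_lattice_def by (rule CollectI, rule exI[of _ "\<lambda>_. 0"]) simp

lemma root_lattice_add:
  assumes "x \<in> root_lattice R" "y \<in> root_lattice R"
  shows "x + y \<in> root_lattice R"
proof -
  obtain c d :: "'a \<Rightarrow> int" where
    "x = (\<Sum>\<alpha>\<in>R. of_int (c \<alpha>) *\<^sub>R \<alpha>)" "y = (\<Sum>\<alpha>\<in>R. of_int (d \<alpha>) *\<^sub>R \<alpha>)"
    using assms unfolding root_lattice_def by blast
  then have "x + y = (\<Sum>\<alpha>\<in>R. of_int (c \<alpha> + d \<alpha>) *\<^sub>R \<alpha>)"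
    by (simp add: scaleR_left_distrib sum.distrib)
  then show ?thesis unfolding root_lattice_def by (intro CollectI exI)
qed

lemma root_lattice_scale:
  assumes "x \<in> root_lattice R"
  shows "of_int n *\<^sub>R x \<in> root_lattice R"
proof -
  obtain c :: "'a \<Rightarrow> int" where "x = (\<Sum>\<alpha>\<in>R. of_int (c \<alpha>) *\<^sub>R \<alpha>)"
    using assms unfolding root_lattice_def by blast
  then have "of_int n *\<^sub>R x = (\<Sum>\<alpha>\<in>R. of_int (n * c \<alpha>) *\<^sub>R \<alpha>)"
    by (simp add: scaleR_sum_right)
  then show ?thesis unfolding root_lattice_def by (intro CollectI exI)
qed

lemma root_lattice_superset:
  assumes "finite R" "\<alpha> \<in> R"
  shows "\<alpha> \<in> root_lattice R"
proof -
  have "(\<Sum>\<beta>\<in>R. of_int (if \<beta> = \<alpha> then 1 else 0) *\<^sub>R \<beta>) = (\<Sum>\<beta>\<in>R. if \<beta> = \<alpha> then \<beta> else 0)"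
    by (rule sum.cong) auto
  also have "\<dots> = \<alpha>" using assms by simp
  finally have "\<alpha> = (\<Sum>\<beta>\<in>R. of_int (if \<beta> = \<alpha> then 1 else 0) *\<^sub>R \<beta>)" by (rule sym)
  then show ?thesis unfolding root_lattice_def by (intro CollectI exI)
qed

lemma lattice_Hom_scale:
  fixes f :: "'a::euclidean_space \<Rightarrow> int"
  assumes f: "f \<in> lattice_Hom (root_lattice R)" and x: "x \<in> root_lattice R"
  shows "f (of_int n *\<^sub>R x) = n * f x"
proof -
  have add: "f (u + v) = f u + f v" if "u \<in> root_lattice R" "v \<in> root_lattice R" for u v
    using f that unfolding lattice_Hom_def by blast
  have f0: "f 0 = 0" using add[OF root_lattice_0 root_lattice_0] by simp
  have nn: "f (of_int (int k) *\<^sub>R x) = int k * f x" for k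
  proof (induction k)
    case 0 then show ?case using f0 by simp
  next
    case (Suc k)
    have "of_int (int (Suc k)) *\<^sub>R x = of_int (int k) *\<^sub>R x + x"
      by (simp add: scaleR_left_distrib)
    then show ?case using Suc add[OF root_lattice_scale[OF x, of "int k"] x]
      by (simp add: algebra_simps)
  qed
  show ?thesis
  proof (cases "n \<ge> 0")
    case True then show ?thesis using nn[of "nat n"] by simp
  next
    case False
    have "f (of_int n *\<^sub>R x + of_int (- n) *\<^sub>R x) = f (of_int n *\<^sub>R x) + f (of_int (- n) *\<^sub>R x)"
      by (rule add[OF root_lattice_scale[OF x] root_lattice_scale[OF x]])
    moreover have "f (of_int (- n) *\<^sub>R x) = - n * f x"
      using nn[of "nat (- n)"] False by simp
    ultimately show ?thesis using f0 by simp
  qed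
qed

lemma lattice_Hom_sum:
  fixes f :: "'a::euclidean_space \<Rightarrow> int"
  assumes f: "f \<in> lattice_Hom (root_lattice R)" and "finite A" "A \<subseteq> root_lattice R"
  shows "(\<Sum>\<alpha>\<in>A. of_int (c \<alpha>) *\<^sub>R \<alpha>) \<in> root_lattice R \<and>
    f (\<Sum>\<alpha>\<in>A. of_int (c \<alpha>) *\<^sub>R \<alpha>) = (\<Sum>\<alpha>\<in>A. c \<alpha> * f \<alpha>)"
  using assms(2,3)
proof (induction A rule: finite_induct)
  case empty
  show ?case using root_lattice_0 lattice_Hom_scale[OF f root_lattice_0, of 0] by simp
next
  case (insert a A)
  have a: "of_int (c a) *\<^sub>R a \<in> root_lattice R" "f (of_int (c a) *\<^sub>R a) = c a * f a"
    using insert.prems lattice_Hom_scale[OF f] root_lattice_scale by auto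
  have add: "f (u + v) = f u + f v" if "u \<in> root_lattice R" "v \<in> root_lattice R" for u v
    using f that unfolding lattice_Hom_def by blast
  show ?case using insert a add root_lattice_add by auto
qed

lemma root_int_comb:
  assumes "root_base R B" "\<alpha> \<in> R"
  shows "\<exists>c :: 'a::euclidean_space \<Rightarrow> int. \<alpha> = (\<Sum>\<beta>\<in>B. of_int (c \<beta>) *\<^sub>R \<beta>)"
proof -
  consider "nonneg_comb B \<alpha>" | "nonneg_comb B (- \<alpha>)"
    using assms unfolding root_base_def by blast
  then show ?thesis
  proof cases
    case 1
    then obtain d :: "'a \<Rightarrow> nat" where "\<alpha> = (\<Sum>\<beta>\<in>B. of_nat (d \<beta>) *\<^sub>R \<beta>)"
      unfolding nonneg_comb_def by blast
    then show ?thesis by (intro exI[of _ "\<lambda>\<beta>. int (d \<beta>)"]) simp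
  next
    case 2
    then obtain d :: "'a \<Rightarrow> nat" where "- \<alpha> = (\<Sum>\<beta>\<in>B. of_nat (d \<beta>) *\<^sub>R \<beta>)"
      unfolding nonneg_comb_def by blast
    then have "\<alpha> = (\<Sum>\<beta>\<in>B. of_int (- int (d \<beta>)) *\<^sub>R \<beta>)"
      by (metis (mono_tags, lifting) add.inverse_inverse of_int_minus of_int_of_nat_eq
          scaleR_minus_left sum.cong sum_negf)
    then show ?thesis by (intro exI[of _ "\<lambda>\<beta>. - int (d \<beta>)"])
  qed
qed

lemma representation_root_lattice_Ints:
  assumes R: "root_system R" and B: "root_base R B" and x: "x \<in> root_lattice R"
  shows "representation B x b \<in> \<int>"
proof -
  have iB: "independent B" and sB: "\<And>v. v \<in> span B" using B by (auto simp: root_base_def)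
  have fB: "finite B" using iB by (rule independent_imp_finite)
  have root: "representation B \<alpha> b \<in> \<int>" if "\<alpha> \<in> R" for \<alpha>
  proof -
    obtain c :: "'a \<Rightarrow> int" where c: "\<alpha> = (\<Sum>\<beta>\<in>B. of_int (c \<beta>) *\<^sub>R \<beta>)"
      using root_int_comb[OF B \<open>\<alpha> \<in> R\<close>] by blast
    have "representation B \<alpha> b = (\<Sum>\<beta>\<in>B. of_int (c \<beta>) * representation B \<beta> b)"
      by (subst c) (simp add: representation_sum representation_scale iB sB)
    also have "\<dots> \<in> \<int>"
      by (intro Ints_sum Ints_mult) (auto simp: representation_basis[OF iB])
    finally show ?thesis .
  qed
  obtain c :: "'a \<Rightarrow> int" where c: "x = (\<Sum>\<alpha>\<in>R. of_int (c \<alpha>) *\<^sub>R \<alpha>)"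
    using x unfolding root_lattice_def by blast
  have "representation B x b = (\<Sum>\<alpha>\<in>R. of_int (c \<alpha>) * representation B \<alpha> b)"
    by (subst c) (simp add: representation_sum representation_scale iB sB)
  also have "\<dots> \<in> \<int>" using root by (intro Ints_sum Ints_mult) auto
  finally show ?thesis .
qed

lemma ex1_chi:
  fixes R B S :: "'a::euclidean_space set"
  assumes R: "root_system R" and B: "root_base R B" and S: "S \<subseteq> B"
  shows "\<exists>!f :: 'a \<Rightarrow> int. f \<in> lattice_Hom (root_lattice R) \<and>
     (\<forall>\<alpha>\<in>S. f \<alpha> = 1) \<and> (\<forall>\<alpha>\<in>B - S. f \<alpha> = 0)"
proof -
  let ?Q = "root_lattice R"
  have fR: "finite R" using R by (simp add: root_system_def)
  have iB: "independent B" and sB: "\<And>v. v \<in> span B" and BR: "B \<subseteq> R"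
    using B by (auto simp: root_base_def)
  have fB: "finite B" using iB by (rule independent_imp_finite)
  have fS: "finite S" using fB S by (rule rev_finite_subset)
  have RQ: "R \<subseteq> ?Q" using root_lattice_superset[OF fR] by blast
  define f where "f = restrict (\<lambda>x. \<lfloor>\<Sum>\<beta>\<in>S. representation B x \<beta>\<rfloor>) ?Q"
  have int: "(\<Sum>\<beta>\<in>S. representation B x \<beta>) \<in> \<int>" if "x \<in> ?Q" for x
    using representation_root_lattice_Ints[OF R B that] by (intro Ints_sum)
  have fhom: "f \<in> lattice_Hom ?Q"
    unfolding lattice_Hom_def
  proof (intro CollectI conjI ballI)
    show "f \<in> extensional ?Q" by (simp add: f_def)
    fix x y assume xy: "x \<in> ?Q" "y \<in> ?Q"
    show "f (x + y) = f x + f y"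
      using xy int[OF xy(1)] int[OF xy(2)] root_lattice_add[OF xy]
      by (simp add: f_def representation_add[OF iB sB sB] sum.distrib)
  qed
  have fB': "f \<alpha> = (if \<alpha> \<in> S then 1 else 0)" if "\<alpha> \<in> B" for \<alpha>
    using that BR RQ fS by (auto simp: f_def representation_basis[OF iB])
  show ?thesis
  proof (rule ex1I[of _ f])
    show "f \<in> lattice_Hom ?Q \<and> (\<forall>\<alpha>\<in>S. f \<alpha> = 1) \<and> (\<forall>\<alpha>\<in>B - S. f \<alpha> = 0)"
      using fhom fB' S by auto
  next
    fix g :: "'a \<Rightarrow> int"
    assume g: "g \<in> lattice_Hom ?Q \<and> (\<forall>\<alpha>\<in>S. g \<alpha> = 1) \<and> (\<forall>\<alpha>\<in>B - S. g \<alpha> = 0)"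
    then have ghom: "g \<in> lattice_Hom ?Q" by blast
    have gB: "g \<alpha> = f \<alpha>" if "\<alpha> \<in> B" for \<alpha> using g fB' that by auto
    have gR: "g \<alpha> = f \<alpha>" if \<alpha>: "\<alpha> \<in> R" for \<alpha>
    proof -
      obtain c :: "'a \<Rightarrow> int" where c: "\<alpha> = (\<Sum>\<beta>\<in>B. of_int (c \<beta>) *\<^sub>R \<beta>)"
        using root_int_comb[OF B \<alpha>] by blast
      have BQ: "B \<subseteq> ?Q" using BR RQ by blast
      show ?thesis
        using lattice_Hom_sum[OF ghom fB BQ, of c] lattice_Hom_sum[OF fhom fB BQ, of c] gB
        by (simp flip: c cong: sum.cong)
    qed
    show "g = f"
    proof (rule extensionalityI[of _ ?Q])
      show "g \<in> extensional ?Q" "f \<in> extensional ?Q"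
        using ghom fhom by (auto simp: lattice_Hom_def)
      fix x assume "x \<in> ?Q"
      then obtain c :: "'a \<Rightarrow> int" where c: "x = (\<Sum>\<alpha>\<in>R. of_int (c \<alpha>) *\<^sub>R \<alpha>)"
        unfolding root_lattice_def by blast
      show "g x = f x"
        using lattice_Hom_sum[OF ghom fR RQ, of c] lattice_Hom_sum[OF fhom fR RQ, of c] gR
        by (simp flip: c cong: sum.cong)
    qed
  qed
qed

end

theory Submission
  imports Defs
begin

text \<open>
  Write \<open>x\<close> as \<open>\<mu>\<close> minus a nonnegative combination \<open>\<delta>\<close> of simple roots, for a root \<open>x\<close> with
  \<open>\<chi>\<^sub>T(x) = \<chi>\<^sub>T(\<mu>)\<close>. The support of \<open>\<delta>\<close> always lies in the component \<open>C\<close> of \<open>-\<mu>\<close> in the extended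
  diagram without \<open>T\<close>, and it exhausts \<open>C - {-\<mu>}\<close> when \<open>x\<close> has least height.
  Hence \<open>C \<inter> S = {}\<close> iff every root with \<open>\<chi>\<^sub>T(x) = \<chi>\<^sub>T(\<mu>)\<close> also has \<open>\<chi>\<^sub>S(x) = \<chi>\<^sub>S(\<mu>)\<close>. In the case
  \<open>\<chi>\<^sub>S(\<mu>) = \<chi>\<^sub>T(\<mu>) = 2\<close> this excludes precisely the values \<open>(0,2)\<close> and \<open>(1,2)\<close>, the only elements of
  \<open>{0,1,2}\<^sup>2\<close> outside \<open>BC\<^sub>2 \<union> {0}\<close>.
\<close>

section \<open>Roots in coordinates over the base\<close>

locale highest_root_base =
  fixes R B :: "'a::euclidean_space set" and \<mu> :: 'a
  assumes root_system: "root_system R"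
    and root_base: "root_base R B"
    and highest_root: "highest_root R B \<mu>"
begin

abbreviation coord :: "'a \<Rightarrow> 'a \<Rightarrow> real" where
  "coord x b \<equiv> representation B x b"

text \<open>For \<open>A \<subseteq> B\<close> this agrees with \<open>chi R B A\<close> on roots
  (see \<open>chi_eq_wt\<close>), but it is real-valued and linear on the whole space, so it can be
  evaluated on reflections term by term. \<open>wt B\<close> is the height.\<close>

definition wt :: "'a set \<Rightarrow> 'a \<Rightarrow> real" where
  "wt A x = (\<Sum>b\<in>A. coord x b)"

lemma finite_roots: "finite R"
  using root_system by (simp add: root_system_def)

lemma base_subset: "B \<subseteq> R" and independent_base: "independent B" and in_span_base: "x \<in> span B"
  using root_base by (auto simp: root_base_def)

lemma finite_base: "finite B"
  using independent_base by (rule independent_imp_finite)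

lemma roots_subset_lattice: "R \<subseteq> root_lattice R"
  using root_lattice_superset[OF finite_roots] by blast

lemma highest_root_in_roots: "\<mu> \<in> R"
  using highest_root by (simp add: highest_root_def)

lemma root_nonzero: "\<alpha> \<in> R \<Longrightarrow> \<alpha> \<noteq> 0"
  using root_system by (auto simp: root_system_def)

lemma reflection_in_roots:
  "\<alpha> \<in> R \<Longrightarrow> \<beta> \<in> R \<Longrightarrow> \<beta> - (2 * (\<beta> \<bullet> \<alpha>) / (\<alpha> \<bullet> \<alpha>)) *\<^sub>R \<alpha> \<in> R"
  using root_system by (simp add: root_system_def)

lemma uminus_in_roots:
  assumes "\<alpha> \<in> R"
  shows "- \<alpha> \<in> R"
proof -
  have "\<alpha> - (2 * (\<alpha> \<bullet> \<alpha>) / (\<alpha> \<bullet> \<alpha>)) *\<^sub>R \<alpha> = \<alpha> - 2 *\<^sub>R \<alpha>"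
    using root_nonzero[OF assms] by simp
  also have "\<dots> = - \<alpha>" by (simp add: scaleR_2)
  finally show ?thesis using reflection_in_roots[OF assms assms] by simp
qed

lemma coord_diff [simp]: "coord (x - y) b = coord x b - coord y b"
  by (rule fun_cong[OF representation_diff[OF independent_base in_span_base in_span_base], simplified])

lemma coord_uminus [simp]: "coord (- x) b = - coord x b"
  using fun_cong[OF representation_neg[OF independent_base in_span_base]] by simp

lemma coord_scaleR [simp]: "coord (c *\<^sub>R x) b = c * coord x b"
  using fun_cong[OF representation_scale[OF independent_base in_span_base]] by simp

lemma coord_base: "a \<in> B \<Longrightarrow> coord a b = (if b = a then 1 else 0)"
  using representation_basis[OF independent_base] by auto

lemma coord_eq_0: "b \<notin> B \<Longrightarrow> coord x b = 0"
  using representation_ne_zero by blast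

lemma coord_comb: "b \<in> B \<Longrightarrow> coord (\<Sum>a\<in>B. c a *\<^sub>R a) b = c b"
  using finite_base
  by (simp add: representation_sum[OF independent_base in_span_base] coord_base if_distrib
      cong: if_cong)

lemma sum_coord: "(\<Sum>b\<in>B. coord x b *\<^sub>R b) = x"
  by (rule sum_representation_eq[OF independent_base in_span_base finite_base order_refl])

lemma inner_coord: "x \<bullet> y = (\<Sum>b\<in>B. coord x b * (b \<bullet> y))"
  by (subst sum_coord[of x, symmetric]) (simp add: inner_sum_left)

section \<open>Signs of coordinates, and angles with simple roots\<close>

lemma coord_nonneg: "nonneg_comb B x \<Longrightarrow> 0 \<le> coord x b"
  by (cases "b \<in> B") (auto simp: nonneg_comb_def coord_comb coord_eq_0)

lemma root_sign:
  assumes "\<alpha> \<in> R"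
  shows "(\<forall>b. 0 \<le> coord \<alpha> b) \<or> (\<forall>b. coord \<alpha> b \<le> 0)"
  using root_base assms coord_nonneg[of \<alpha>] coord_nonneg[of "- \<alpha>"]
  by (force simp: root_base_def)

lemma coord_le_highest: "\<alpha> \<in> R \<Longrightarrow> coord \<alpha> b \<le> coord \<mu> b"
  using highest_root coord_nonneg[of "\<mu> - \<alpha>" b] by (simp add: highest_root_def)

lemma coord_highest_ge_1: "b \<in> B \<Longrightarrow> 1 \<le> coord \<mu> b"
  using coord_le_highest[of b b] base_subset by (auto simp: coord_base)

lemma uminus_highest_notin_base: "- \<mu> \<notin> B"
proof
  assume "- \<mu> \<in> B"
  then have "coord (- \<mu>) (- \<mu>) = 1" "1 \<le> coord \<mu> (- \<mu>)"
    using coord_highest_ge_1 by (auto simp: coord_base simp del: coord_uminus)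
  then show False by simp
qed

text \<open>Otherwise reflecting \<open>a\<close> in \<open>b\<close> gives a root with coordinates
  of both signs: \<open>1\<close> at \<open>a\<close> and \<open>- k < 0\<close> at
  \<open>b\<close>.\<close>

lemma simple_inner_nonpos:
  assumes "a \<in> B" "b \<in> B" "a \<noteq> b"
  shows "a \<bullet> b \<le> 0"
proof (rule ccontr)
  assume "\<not> a \<bullet> b \<le> 0"
  define k where "k = 2 * (a \<bullet> b) / (b \<bullet> b)"
  have "k > 0"
    using \<open>\<not> a \<bullet> b \<le> 0\<close> root_nonzero[of b] assms base_subset
    by (auto simp: k_def intro!: divide_pos_pos)
  have "a - k *\<^sub>R b \<in> R"
    unfolding k_def using assms base_subset by (intro reflection_in_roots) auto
  moreover have "coord (a - k *\<^sub>R b) a = 1" "coord (a - k *\<^sub>R b) b = - k"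
    using assms by (auto simp: coord_base)
  ultimately show False
    using root_sign[of "a - k *\<^sub>R b"] \<open>k > 0\<close>
    by (metis neg_0_le_iff_le not_less zero_less_one)
qed

text \<open>Otherwise reflecting \<open>\<mu>\<close> in \<open>b\<close> raises the coordinate at
  \<open>b\<close> beyond its maximum over all roots.\<close>

lemma highest_inner_nonneg:
  assumes "b \<in> B"
  shows "0 \<le> \<mu> \<bullet> b"
proof (rule ccontr)
  assume neg: "\<not> 0 \<le> \<mu> \<bullet> b"
  define k where "k = 2 * (\<mu> \<bullet> b) / (b \<bullet> b)"
  have "b \<in> R" using assms base_subset by blast
  have "k < 0"
    using neg root_nonzero[OF \<open>b \<in> R\<close>] by (auto simp: k_def intro!: divide_neg_pos)
  have "\<mu> - k *\<^sub>R b \<in> R"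
    unfolding k_def using \<open>b \<in> R\<close> by (intro reflection_in_roots highest_root_in_roots)
  then show False
    using coord_le_highest[of "\<mu> - k *\<^sub>R b" b] assms \<open>k < 0\<close> by (simp add: coord_base)
qed

section \<open>Weights, the homomorphisms \<open>chi\<close>, and short roots\<close>

lemma wt_diff: "wt A (x - y) = wt A x - wt A y"
  by (simp add: wt_def sum_subtractf)

lemma wt_scaleR: "wt A (c *\<^sub>R x) = c * wt A x"
  by (simp add: wt_def sum_distrib_left)

lemma wt_uminus: "wt A (- x) = - wt A x"
  by (simp add: wt_def sum_negf)

lemma wt_base: "A \<subseteq> B \<Longrightarrow> b \<in> B \<Longrightarrow> wt A b = (if b \<in> A then 1 else 0)"
  using finite_subset[OF _ finite_base, of A] by (simp add: wt_def coord_base)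

lemma wt_le_highest: "\<alpha> \<in> R \<Longrightarrow> wt A \<alpha> \<le> wt A \<mu>"
  unfolding wt_def by (intro sum_mono coord_le_highest)

text \<open>The differences \<open>coord \<mu> a - coord \<alpha> a\<close> are nonnegative and sum
  to zero over \<open>A\<close>, so each of them vanishes.\<close>

lemma coord_eq_highest:
  assumes "A \<subseteq> B" "\<alpha> \<in> R" "wt A \<alpha> = wt A \<mu>" "b \<in> A"
  shows "coord \<alpha> b = coord \<mu> b"
proof -
  have "(\<Sum>a\<in>A. coord \<mu> a - coord \<alpha> a) = 0"
    using assms(3) by (simp add: wt_def sum_subtractf)
  then have "coord \<mu> b - coord \<alpha> b = 0"
    using assms coord_le_highest[OF assms(2)] finite_subset[OF assms(1) finite_base]
    by (subst (asm) sum_nonneg_eq_0_iff) auto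
  then show ?thesis by simp
qed

lemma chi_props:
  assumes "S \<subseteq> B"
  shows "chi R B S \<in> lattice_Hom (root_lattice R)"
    and "b \<in> B \<Longrightarrow> chi R B S b = (if b \<in> S then 1 else 0)"
  using theI'[OF ex1_chi[OF root_system root_base assms]] by (auto simp: chi_def)

lemma chi_eq_wt:
  assumes "S \<subseteq> B" "\<alpha> \<in> R"
  shows "of_int (chi R B S \<alpha>) = wt S \<alpha>"
proof -
  obtain c :: "'a \<Rightarrow> int" where c: "\<alpha> = (\<Sum>b\<in>B. of_int (c b) *\<^sub>R b)"
    using root_int_comb[OF root_base assms(2)] by blast
  have "chi R B S \<alpha> = (\<Sum>b\<in>B. c b * chi R B S b)"
    using lattice_Hom_sum[OF chi_props(1)[OF assms(1)] finite_base, of c] base_subset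
      roots_subset_lattice by (simp flip: c)
  also have "\<dots> = (\<Sum>b\<in>B. if b \<in> S then c b else 0)"
    using chi_props(2)[OF assms(1)] by (intro sum.cong) auto
  also have "\<dots> = (\<Sum>b\<in>S. c b)"
    using assms(1) finite_base by (simp add: sum.If_cases Int_absorb1)
  finally have "of_int (chi R B S \<alpha>) = (\<Sum>b\<in>S. of_int (c b) :: real)" by simp
  also have "\<dots> = wt S \<alpha>"
    unfolding wt_def using assms(1) by (intro sum.cong refl, subst c, subst coord_comb) auto
  finally show ?thesis .
qed

lemma chi_pair_root: "\<alpha> \<in> R \<Longrightarrow> chi_pair R B S T \<alpha> = (chi R B S \<alpha>, chi R B T \<alpha>)"
  using roots_subset_lattice by (auto simp: chi_pair_def)

lemma chi_pair_in_Hom_BC2_iff: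
  assumes "S \<subseteq> B" "T \<subseteq> B"
  shows "chi_pair R B S T \<in> Hom_BC2 R \<longleftrightarrow> (\<forall>\<alpha>\<in>R. (chi R B S \<alpha>, chi R B T \<alpha>) \<in> BC2 \<union> {0})"
proof -
  have "chi_pair R B S T \<in> lattice_Hom (root_lattice R)"
    using chi_props(1)[OF assms(1)] chi_props(1)[OF assms(2)]
    by (auto simp: chi_pair_def lattice_Hom_def root_lattice_add)
  then show ?thesis by (auto simp: Hom_BC2_def image_subset_iff chi_pair_root)
qed

text \<open>A simple root in \<open>S\<close> has value \<open>(1,0)\<close> or
  \<open>(1,1)\<close>, both short. Conversely, short roots have nonzero first coordinate, whereas
  \<open>chi R B {}\<close> vanishes on all roots.\<close>

lemma SPA_iff:
  assumes "S \<subseteq> B" "T \<subseteq> B"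
  shows "(S, T) \<in> SPA R B \<longleftrightarrow> S \<noteq> {} \<and> chi_pair R B S T \<in> Hom_BC2 R"
proof -
  have "chi_pair R B S T ` R \<inter> BC2_short \<noteq> {} \<longleftrightarrow> S \<noteq> {}"
  proof
    assume "chi_pair R B S T ` R \<inter> BC2_short \<noteq> {}"
    then obtain \<alpha> where "\<alpha> \<in> R" "chi R B S \<alpha> \<noteq> 0"
      by (auto simp: BC2_short_def chi_pair_root)
    then show "S \<noteq> {}" using chi_eq_wt[OF assms(1), of \<alpha>] by (auto simp: wt_def)
  next
    assume "S \<noteq> {}"
    then obtain b where b: "b \<in> S" "b \<in> B" "b \<in> R" using assms base_subset by blast
    then have "chi_pair R B S T b \<in> BC2_short"
      using chi_pair_root[of b] chi_props(2)[OF assms(1)] chi_props(2)[OF assms(2)]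
      by (auto simp: BC2_short_def)
    then show "chi_pair R B S T ` R \<inter> BC2_short \<noteq> {}" using b by blast
  qed
  then show ?thesis using assms by (auto simp: SPA_def Hom_sh_BC2_def)
qed

section \<open>The component of \<open>- \<mu>\<close> and the support of
  \<open>\<mu> - x\<close>\<close>

lemma exists_lowest_root:
  assumes T: "T \<subseteq> B"
  obtains x where "x \<in> R" "wt T x = wt T \<mu>" "\<And>b. b \<in> B - T \<Longrightarrow> x \<bullet> b \<le> 0"
proof -
  let ?X = "{x \<in> R. wt T x = wt T \<mu>}"
  have "finite ?X" "?X \<noteq> {}" using finite_roots highest_root_in_roots by auto
  \<comment> \<open>Least height is what makes \<open>x\<close> antidominant off \<open>T\<close>:
    reflecting in \<open>b \<in> B - T\<close> preserves \<open>wt T\<close>, and would lower the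
    height if \<open>x \<bullet> b > 0\<close>.\<close>
  then obtain x where x: "x \<in> ?X" and min: "\<And>y. y \<in> ?X \<Longrightarrow> wt B x \<le> wt B y"
    using ex_is_arg_min_if_finite[of ?X "wt B"] by (auto simp: is_arg_min_linorder)
  have "x \<bullet> b \<le> 0" if b: "b \<in> B - T" for b
  proof (rule ccontr)
    assume pos: "\<not> x \<bullet> b \<le> 0"
    define k where "k = 2 * (x \<bullet> b) / (b \<bullet> b)"
    have "b \<in> R" using b base_subset by blast
    then have "k > 0"
      using pos root_nonzero[of b] by (auto simp: k_def intro!: divide_pos_pos)
    have "x - k *\<^sub>R b \<in> R"
      unfolding k_def using \<open>b \<in> R\<close> x by (intro reflection_in_roots) auto
    then have "x - k *\<^sub>R b \<in> ?X"
      using x b T by (simp add: wt_diff wt_scaleR wt_base)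
    from min[OF this] show False
      using b \<open>k > 0\<close> by (simp add: wt_diff wt_scaleR wt_base)
  qed
  then show thesis using that x by blast
qed

text \<open>Induction along a path from \<open>- \<mu>\<close>. If an edge from \<open>u\<close> led
  to a \<open>v\<close> at which \<open>x\<close> and \<open>\<mu>\<close> agree, then
  \<open>(\<mu> - x) \<bullet> v\<close> would be nonnegative by the signs of
  \<open>\<mu> \<bullet> v\<close> and \<open>x \<bullet> v\<close>, yet a sum of nonpositive terms.
  So everything vanishes, including the term of \<open>u\<close>, which is nonzero.\<close>

lemma component_subset_support:
  assumes T: "T \<subseteq> B" and x: "x \<in> R" and low: "\<And>b. b \<in> B - T \<Longrightarrow> x \<bullet> b \<le> 0"
    and y: "y \<in> diagram_comp (extended_base B \<mu> - T) (- \<mu>)"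
  shows "y = - \<mu> \<or> coord x y < coord \<mu> y"
proof -
  have "(- \<mu>, y) \<in> {(u, v). u \<in> extended_base B \<mu> - T \<and> v \<in> extended_base B \<mu> - T \<and> adjacent u v}\<^sup>*"
    using y by (simp add: diagram_comp_def)
  then show ?thesis
  proof (induction rule: rtrancl_induct)
    case base
    show ?case by simp
  next
    case (step u v)
    then have u: "u \<in> extended_base B \<mu> - T" and v: "v \<in> extended_base B \<mu> - T"
      and uv: "u \<noteq> v" "u \<bullet> v \<noteq> 0" by (auto simp: adjacent_def)
    show ?case
    proof (rule ccontr)
      assume "\<not> (v = - \<mu> \<or> coord x v < coord \<mu> v)"
      then have vB: "v \<in> B - T" and eq: "coord x v = coord \<mu> v"
        using v coord_le_highest[OF x, of v] by (auto simp: extended_base_def)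
      \<comment> \<open>For \<open>b = v\<close> the first factor is zero; for other
        \<open>b\<close> the angle with \<open>v\<close> is not acute.\<close>
      have term_le: "(coord \<mu> b - coord x b) * (b \<bullet> v) \<le> 0" if "b \<in> B" for b
        using that vB eq coord_le_highest[OF x, of b] simple_inner_nonpos[of b v]
        by (cases "b = v") (auto simp: mult_nonneg_nonpos)
      have "(\<mu> - x) \<bullet> v = (\<Sum>b\<in>B. (coord \<mu> b - coord x b) * (b \<bullet> v))"
        by (subst inner_coord) simp
      moreover have "0 \<le> \<mu> \<bullet> v" using highest_inner_nonneg vB by blast
      moreover have "x \<bullet> v \<le> 0" using low vB by blast
      moreover have "(\<Sum>b\<in>B. (coord \<mu> b - coord x b) * (b \<bullet> v)) \<le> 0"
        using term_le by (rule sum_nonpos)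
      ultimately have mu0: "\<mu> \<bullet> v = 0"
        and sum0: "(\<Sum>b\<in>B. (coord \<mu> b - coord x b) * (b \<bullet> v)) = 0"
        by (auto simp: inner_diff_left)
      \<comment> \<open>The start of the path has no coordinate to compare; it is excluded because
        it would be orthogonal to \<open>v\<close>.\<close>
      have "u \<noteq> - \<mu>" using uv mu0 by auto
      then have "u \<in> B" "coord x u < coord \<mu> u"
        using u step.IH by (auto simp: extended_base_def)
      moreover have "(coord \<mu> u - coord x u) * (u \<bullet> v) = 0"
        using sum_nonneg_eq_0_iff[OF finite_base, of "\<lambda>b. - ((coord \<mu> b - coord x b) * (b \<bullet> v))"]
          sum0 term_le \<open>u \<in> B\<close> by (simp add: sum_negf)
      ultimately show False using uv by simp
    qed
  qed
qed

text \<open>Among the roots violating the claim take \<open>z\<close> of greatest height. The part \<open>e\<close> of \<open>\<mu> - z\<close>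
  outside the component is orthogonal to \<open>\<mu>\<close> and to the rest of \<open>\<mu> - z\<close>, so \<open>z \<bullet> e = - (e \<bullet> e) < 0\<close>
  and reflecting \<open>z\<close> in some simple \<open>a\<close> of that part raises the height. By maximality the reflection
  uses up all of \<open>e\<close>, i.e. \<open>e = - k *\<^sub>R a\<close>; but then the coefficient of the reflection is \<open>2 * k\<close>.\<close>

lemma support_subset_component:
  assumes T: "T \<subseteq> B" and x: "x \<in> R" "wt T x = wt T \<mu>" and b: "coord x b < coord \<mu> b"
  shows "b \<in> diagram_comp (extended_base B \<mu> - T) (- \<mu>)"
proof (rule ccontr)
  let ?Y = "extended_base B \<mu> - T"
  define C where "C = diagram_comp ?Y (- \<mu>)"
  assume "b \<notin> diagram_comp ?Y (- \<mu>)"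
  define X where "X = {x \<in> R. wt T x = wt T \<mu> \<and> (\<exists>a\<in>B - C. coord x a < coord \<mu> a)}"
  have "b \<in> B" using b coord_eq_0 by force
  then have "x \<in> X" using \<open>b \<notin> _\<close> x b by (auto simp: X_def C_def)
  moreover have "finite X" using finite_roots by (auto simp: X_def)
  ultimately obtain z where z: "z \<in> X" and max: "\<And>y. y \<in> X \<Longrightarrow> wt B y \<le> wt B z"
    using ex_is_arg_min_if_finite[of X "\<lambda>x. - wt B x"] by (auto simp: is_arg_min_linorder)
  have zR: "z \<in> R" and zT: "wt T z = wt T \<mu>" using z by (auto simp: X_def)
  define d where "d a = coord \<mu> a - coord z a" for a
  define e where "e = (\<Sum>a\<in>B - C. d a *\<^sub>R a)"
  have d_nonneg: "0 \<le> d a" for a using coord_le_highest[OF zR, of a] by (simp add: d_def)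
  have d_T: "d a = 0" if "a \<in> T" for a
    using coord_eq_highest[OF T zR zT that] by (simp add: d_def)
  \<comment> \<open>A vertex outside \<open>T\<close> that is joined to the component belongs to
    it.\<close>
  have orth: "c \<bullet> a = 0" if c: "c \<in> C" and a: "a \<in> B - C - T" for c a
  proof (rule ccontr)
    assume "c \<bullet> a \<noteq> 0"
    then have "adjacent c a" using c a by (auto simp: adjacent_def)
    then have "a \<in> C"
      using c a unfolding C_def diagram_comp_def extended_base_def
      by (auto intro: rtrancl_into_rtrancl)
    then show False using a by simp
  qed
  have "- \<mu> \<in> C"
    using T uminus_highest_notin_base by (auto simp: C_def diagram_comp_def extended_base_def)
  have z_inner: "z \<bullet> a = - (e \<bullet> a)" if a: "a \<in> B - C - T" for a
  proof -
    have "\<mu> \<bullet> a = 0" using orth[OF \<open>- \<mu> \<in> C\<close> a] by simp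
    have "(\<mu> - z) \<bullet> a = (\<Sum>c\<in>B. d c * (c \<bullet> a))"
      by (subst inner_coord) (simp add: d_def)
    also have "\<dots> = (\<Sum>c\<in>B - C. d c * (c \<bullet> a))"
      using orth[OF _ a] finite_base by (intro sum.mono_neutral_right) auto
    also have "\<dots> = e \<bullet> a" by (simp add: e_def inner_sum_left)
    finally show ?thesis using \<open>\<mu> \<bullet> a = 0\<close> by (simp add: inner_diff_left)
  qed
  have "e \<noteq> 0"
  proof
    assume "e = 0"
    obtain a where a: "a \<in> B - C" "d a > 0" using z by (auto simp: X_def d_def)
    \<comment> \<open>Zero coefficients on \<open>C\<close> extend \<open>e\<close> to a sum over
      all of \<open>B\<close>, where coordinates can be read off.\<close>
    have "(\<Sum>a\<in>B. (if a \<in> C then 0 else d a) *\<^sub>R a) = e"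
      unfolding e_def using finite_base by (intro sum.mono_neutral_cong_right) auto
    then have "coord e a = d a" using coord_comb[of a "\<lambda>a. if a \<in> C then 0 else d a"] a by simp
    then show False using a \<open>e = 0\<close> coord_scaleR[of 0 0 a] by simp
  qed
  have "(\<Sum>a\<in>B - C. d a * (z \<bullet> a)) = (\<Sum>a\<in>B - C. - (d a * (e \<bullet> a)))"
    
  proof (intro sum.cong refl)
    \<comment> \<open>On \<open>T\<close> both sides are zero because \<open>d a = 0\<close>; off
      \<open>T\<close> this is \<open>z_inner\<close>.\<close>
    fix a assume "a \<in> B - C"
    then show "d a * (z \<bullet> a) = - (d a * (e \<bullet> a))"
      using z_inner[of a] d_T[of a] by (cases "a \<in> T") auto
  qed
  also have "\<dots> = - (e \<bullet> e)"
    by (subst (3) e_def) (simp add: inner_sum_right sum_negf)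
  also have "\<dots> < 0" using \<open>e \<noteq> 0\<close> by simp
  finally have "\<not> (\<forall>a\<in>B - C. 0 \<le> d a * (z \<bullet> a))"
    using sum_nonneg[of "B - C" "\<lambda>a. d a * (z \<bullet> a)"] by (meson not_less)
  then obtain a where a: "a \<in> B - C" "d a * (z \<bullet> a) < 0" by force
  then have "z \<bullet> a < 0" using d_nonneg[of a] by (meson mult_less_0_iff not_less)
  have aT: "a \<in> B - C - T" using a d_T by force
  have "a \<in> R" "a \<noteq> 0" using a base_subset root_nonzero by auto
  define k where "k = 2 * (z \<bullet> a) / (a \<bullet> a)"
  have "k < 0" using \<open>z \<bullet> a < 0\<close> \<open>a \<noteq> 0\<close> by (auto simp: k_def intro!: divide_neg_pos)
  let ?z = "z - k *\<^sub>R a"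
  have zR': "?z \<in> R" unfolding k_def using \<open>a \<in> R\<close> zR by (intro reflection_in_roots)
  have "wt T ?z = wt T \<mu>" using aT T zT by (simp add: wt_diff wt_scaleR wt_base)
  moreover have "wt B ?z > wt B z"
    using a \<open>k < 0\<close> by (simp add: wt_diff wt_scaleR wt_base)
  \<comment> \<open>Being higher than \<open>z\<close>, the reflected root lies outside
    \<open>X\<close>; the only condition of \<open>X\<close> it can fail is the existence of a
    smaller coordinate outside \<open>C\<close>.\<close>
  ultimately have "coord ?z c = coord \<mu> c" if "c \<in> B - C" for c
    using max[of ?z] zR' that coord_le_highest[OF zR', of c] by (force simp: X_def)
  then have "d c = (if c = a then - k else 0)" if "c \<in> B - C" for c
    using that a by (force simp: d_def coord_base)
  then have "e = (\<Sum>c\<in>B - C. if c = a then - k *\<^sub>R a else 0)"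
    unfolding e_def by (intro sum.cong) auto
  also have "\<dots> = - k *\<^sub>R a" using a finite_base by simp
  finally have "z \<bullet> a = k * (a \<bullet> a)" using z_inner[OF aT] by simp
  then have "k = 2 * k" using \<open>a \<noteq> 0\<close> by (simp add: k_def)
  then show False using \<open>k < 0\<close> by simp
qed

text \<open>Forward, a coordinate in \<open>S\<close> at which \<open>x\<close> falls short of
  \<open>\<mu>\<close> would lie in the component. Backward, the lowest root falls short at every
  vertex of the component except \<open>- \<mu>\<close>, which is not in \<open>S\<close>.\<close>

lemma component_disjoint_iff:
  assumes S: "S \<subseteq> B" and T: "T \<subseteq> B"
  shows "diagram_comp (extended_base B \<mu> - T) (- \<mu>) \<inter> S = {} \<longleftrightarrow>
    (\<forall>x\<in>R. wt T x = wt T \<mu> \<longrightarrow> wt S x = wt S \<mu>)" (is "?C \<inter> S = {} \<longleftrightarrow> ?P")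
proof
  assume "?C \<inter> S = {}"
  then show ?P
    using support_subset_component[OF T] coord_le_highest unfolding wt_def
    by (intro ballI impI sum.cong refl) (metis disjoint_iff order_le_less wt_def)
next
  assume P: ?P
  obtain x where x: "x \<in> R" "wt T x = wt T \<mu>" "\<And>b. b \<in> B - T \<Longrightarrow> x \<bullet> b \<le> 0"
    using exists_lowest_root[OF T] by blast
  have "coord x b = coord \<mu> b" if "b \<in> S" for b
    using coord_eq_highest[OF S x(1) _ that] P x by blast
  then show "?C \<inter> S = {}"
    using component_subset_support[OF T x(1,3)] S uminus_highest_notin_base by fastforce
qed

section \<open>Values of \<open>chi\<close> on roots and membership in \<open>BC2\<close>\<close>

lemma chi_bounds:
  assumes "S \<subseteq> B" "\<alpha> \<in> R" "\<forall>b. 0 \<le> coord \<alpha> b"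
  shows "0 \<le> chi R B S \<alpha>" "chi R B S \<alpha> \<le> chi R B S \<mu>"
proof -
  have "0 \<le> wt S \<alpha>" using assms(3) by (simp add: wt_def sum_nonneg)
  then show "0 \<le> chi R B S \<alpha>" using chi_eq_wt[OF assms(1,2)] by linarith
  show "chi R B S \<alpha> \<le> chi R B S \<mu>"
    using wt_le_highest[OF assms(2), of S] chi_eq_wt[OF assms(1,2)]
      chi_eq_wt[OF assms(1) highest_root_in_roots] by linarith
qed

lemma chi_uminus:
  assumes "S \<subseteq> B" "\<alpha> \<in> R"
  shows "chi R B S (- \<alpha>) = - chi R B S \<alpha>"
  using chi_eq_wt[OF assms] chi_eq_wt[OF assms(1) uminus_in_roots[OF assms(2)]]
  by (simp add: wt_uminus flip: of_int_minus del: of_int_minus)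

lemma chi_highest_pos_iff:
  assumes "S \<subseteq> B"
  shows "1 \<le> chi R B S \<mu> \<longleftrightarrow> S \<noteq> {}"
proof
  assume "1 \<le> chi R B S \<mu>"
  then show "S \<noteq> {}" using chi_eq_wt[OF assms highest_root_in_roots] by (auto simp: wt_def)
next
  assume "S \<noteq> {}"
  then obtain b where b: "b \<in> S" "b \<in> B" "b \<in> R" using assms base_subset by blast
  have "chi R B S b \<le> chi R B S \<mu>" using b by (intro chi_bounds[OF assms]) (auto simp: coord_base)
  then show "1 \<le> chi R B S \<mu>" using chi_props(2)[OF assms] b by simp
qed

lemma highest_nonneg: "0 \<le> coord \<mu> b"
  by (metis coord_eq_0 coord_highest_ge_1 order_refl order_trans zero_le_one)

lemma Hom_BC2_iff:
  assumes S: "S \<subseteq> B" and T: "T \<subseteq> B"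
  shows "S \<noteq> {} \<and> chi_pair R B S T \<in> Hom_BC2 R \<longleftrightarrow>
    chi R B S \<mu> \<in> {1, 2} \<and> chi R B T \<mu> \<in> {0, 1, 2} \<and>
    (chi R B T \<mu> = 2 \<longrightarrow>
      chi R B S \<mu> = 2 \<and> diagram_comp (extended_base B \<mu> - T) (- \<mu>) \<inter> S = {})"
    (is "?lhs \<longleftrightarrow> ?rhs")
proof -
  let ?s = "chi R B S" and ?t = "chi R B T"
  have disjoint_iff: "diagram_comp (extended_base B \<mu> - T) (- \<mu>) \<inter> S = {} \<longleftrightarrow>
      (\<forall>x\<in>R. ?t x = ?t \<mu> \<longrightarrow> ?s x = ?s \<mu>)"
    unfolding component_disjoint_iff[OF S T]
    by (auto simp: highest_root_in_roots simp flip: chi_eq_wt[OF S] chi_eq_wt[OF T])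
  show ?thesis
  proof
    assume ?lhs
    then have BC2: "\<And>x. x \<in> R \<Longrightarrow> (?s x, ?t x) \<in> BC2 \<union> {0}" and "1 \<le> ?s \<mu>"
      using chi_pair_in_Hom_BC2_iff[OF S T] chi_highest_pos_iff[OF S] by auto
    \<comment> \<open>\<open>(2,2)\<close> is the only element of \<open>BC2\<close> with second
      coordinate \<open>2\<close>.\<close>
    have "?s x = 2" if "x \<in> R" "?t x = 2" for x
      using BC2[OF that(1)] that(2) by (auto simp: BC2_def zero_prod_def)
    moreover have "?s \<mu> \<in> {1, 2}" "?t \<mu> \<in> {0, 1, 2}"
      using BC2[OF highest_root_in_roots] \<open>1 \<le> ?s \<mu>\<close>
        chi_bounds(1)[OF T highest_root_in_roots] highest_nonneg
      by (auto simp: BC2_def zero_prod_def)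
    ultimately show ?rhs
      unfolding disjoint_iff using highest_root_in_roots by auto
  next
    assume rhs: ?rhs
    \<comment> \<open>On positive roots both values lie between \<open>0\<close> and those at
      \<open>\<mu>\<close>. If \<open>?t x = 2\<close>, then \<open>?t \<mu> = 2\<close> as well,
      and disjointness forces \<open>?s x = ?s \<mu> = 2\<close>.\<close>
    have pos: "(?s x, ?t x) \<in> BC2 \<union> {0}" if x: "x \<in> R" "\<forall>b. 0 \<le> coord x b" for x
    proof -
      have "?s x \<in> {0, 1, 2}"
        using chi_bounds[OF S x] rhs by auto
      moreover have "?t x \<in> {0, 1} \<or> ?t x = 2 \<and> ?s x = 2"
      proof (cases "?t x = 2")
        case True
        then have "?t \<mu> = 2" using chi_bounds(2)[OF T x] rhs by auto
        then show ?thesis using True rhs x(1) unfolding disjoint_iff by simp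
      next
        case False
        then show ?thesis using chi_bounds[OF T x] rhs by auto
      qed
      ultimately show ?thesis
        unfolding BC2_def zero_prod_def by (elim disjE insertE conjE) simp_all
    qed
    \<comment> \<open>Negative roots follow from the symmetry of \<open>BC2\<close> under
      negation.\<close>
    have "(?s x, ?t x) \<in> BC2 \<union> {0}" if x: "x \<in> R" for x
    proof (cases "\<forall>b. 0 \<le> coord x b")
      case True
      then show ?thesis using pos x by blast
    next
      case False
      then have "\<forall>b. 0 \<le> coord (- x) b" using root_sign[OF x] by auto
      then have "(- ?s x, - ?t x) \<in> BC2 \<union> {0}"
        using pos[OF uminus_in_roots[OF x]] chi_uminus[OF S x] chi_uminus[OF T x] by simp
      then show ?thesis unfolding BC2_def zero_prod_def by simp presburger
    qed
    then show ?lhs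
      using rhs chi_pair_in_Hom_BC2_iff[OF S T] chi_highest_pos_iff[OF S] by auto
  qed
qed

end

theorem proposition7p1p5:
  fixes R B S T :: "'a::euclidean_space set" and \<mu> :: 'a
  assumes "root_system R" and "reduced_roots R" and "irreducible_roots R"
    and "root_base R B" and "highest_root R B \<mu>"
    and "S \<subseteq> B" and "T \<subseteq> B"
  shows "((S, T) \<in> SPA R B \<longleftrightarrow> S \<noteq> {} \<and> chi_pair R B S T \<in> Hom_BC2 R) \<and>
    (S \<noteq> {} \<and> chi_pair R B S T \<in> Hom_BC2 R \<longleftrightarrow>
      chi R B S \<mu> \<in> {1, 2} \<and> chi R B T \<mu> \<in> {0, 1, 2} \<and>
      (chi R B T \<mu> = 2 \<longrightarrow>
        chi R B S \<mu> = 2 \<and> diagram_comp (extended_base B \<mu> - T) (- \<mu>) \<inter> S = {}))"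
proof -
  interpret highest_root_base R B \<mu>
    using assms by unfold_locales
  show ?thesis
    using SPA_iff[OF assms(6,7)] Hom_BC2_iff[OF assms(6,7)] by blast
qed

end
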